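(* Let $D$ be a commutative ring, let $I$ be an integrally closed ideal of $D$, and set $R := D/I$. Let $n\in\mathbb{N}$ and let $A$ be a principled $n\times n$-matrix over $R$. Then $A^m$ is principled for every $m \in \mathbb{N}$.
   Context: All rings are commutative, associative and unital; $\mathbb{N}=\{0,1,2,\ldots\}$ and $[n]:=\{1,2,\ldots,n\}$. For an $n\times n$-matrix $A=(a_{i,j})_{i,j\in[n]}$ over a ring and $S\subseteq[n]$, $A_S$ denotes the principal submatrix of $A$ with row and column set $S$; the empty determinant is $1$. The matrix $A$ is called principled if $\det A_S = \prod_{i\in S} a_{i,i}$ for every $S\subseteq[n]$. Let $D$ be a commutative ring and $I$ an ideal of $D$. An element $x\in D$ is integral over $I$ if there exist a positive integer $d$ and elements $c_j\in I^j$ for all $j\in[d]$ such that $x^d+c_1x^{d-1}+c_2x^{d-2}+\cdots+c_d=0$. The integral closure $\overline{I}$ is the set of all elements of $D$ integral over $I$. The ideal $I$ is integrally closed if $\overline{I}=I$. *)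

theory Defs
  imports "HOL-Algebra.Algebra" "HOL-Combinatorics.Permutations"
begin

text \<open>
  The library determinants live on type classes, which exclude quotients \<open>D Quot I\<close> of an
  arbitrary ring by an ideal (and the zero ring). Here an \<open>n \<times> n\<close>-matrix over \<open>R\<close> is a function
  \<open>A :: nat \<Rightarrow> nat \<Rightarrow> 'a\<close> with indices \<open>1, \<dots>, n\<close>; values outside this range play no role.
\<close>

definition matrices :: "('a, 'b) ring_scheme \<Rightarrow> nat \<Rightarrow> (nat \<Rightarrow> nat \<Rightarrow> 'a) set" where
  "matrices R n = ({1..n} \<rightarrow> {1..n} \<rightarrow> carrier R)"

definition mat_one :: "('a, 'b) ring_scheme \<Rightarrow> nat \<Rightarrow> nat \<Rightarrow> 'a" where
  "mat_one R = (\<lambda>i j. if i = j then \<one>\<^bsub>R\<^esub> else \<zero>\<^bsub>R\<^esub>)"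

definition mat_mult ::
  "('a, 'b) ring_scheme \<Rightarrow> nat \<Rightarrow> (nat \<Rightarrow> nat \<Rightarrow> 'a) \<Rightarrow> (nat \<Rightarrow> nat \<Rightarrow> 'a) \<Rightarrow> nat \<Rightarrow> nat \<Rightarrow> 'a" where
  "mat_mult R n A B = (\<lambda>i j. \<Oplus>\<^bsub>R\<^esub>k\<in>{1..n}. A i k \<otimes>\<^bsub>R\<^esub> B k j)"

primrec mat_power ::
  "('a, 'b) ring_scheme \<Rightarrow> nat \<Rightarrow> (nat \<Rightarrow> nat \<Rightarrow> 'a) \<Rightarrow> nat \<Rightarrow> nat \<Rightarrow> nat \<Rightarrow> 'a" where
  "mat_power R n A 0 = mat_one R"
| "mat_power R n A (Suc m) = mat_mult R n (mat_power R n A m) A"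

text \<open>
  Leibniz formula for the determinant of the principal submatrix \<open>A\<^sub>S\<close>, whose rows and columns
  keep their labels in the finite set \<open>S\<close>; \<open>S = {1..n}\<close> gives the determinant of \<open>A\<close> itself.
  The library constant \<open>add_pow\<close> is the integer multiple in \<open>R\<close>, here by the sign \<open>\<plusminus>1\<close>.
\<close>

definition principal_det ::
  "('a, 'b) ring_scheme \<Rightarrow> (nat \<Rightarrow> nat \<Rightarrow> 'a) \<Rightarrow> nat set \<Rightarrow> 'a" where
  "principal_det R A S =
    (\<Oplus>\<^bsub>R\<^esub>p\<in>{p. p permutes S}. add_pow R (sign p) (\<Otimes>\<^bsub>R\<^esub>i\<in>S. A i (p i)))"

definition principled :: "('a, 'b) ring_scheme \<Rightarrow> nat \<Rightarrow> (nat \<Rightarrow> nat \<Rightarrow> 'a) \<Rightarrow> bool" where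
  "principled R n A \<longleftrightarrow>
    (\<forall>S. S \<subseteq> {1..n} \<longrightarrow> principal_det R A S = (\<Otimes>\<^bsub>R\<^esub>i\<in>S. A i i))"

text \<open>
  The power \<open>I\<^sup>j\<close> of an ideal is taken in the library semiring \<open>ideals_set D\<close>, whose multiplication
  is the product of ideals.
\<close>

definition integral_over :: "('a, 'b) ring_scheme \<Rightarrow> 'a set \<Rightarrow> 'a \<Rightarrow> bool" where
  "integral_over D I x \<longleftrightarrow>
    (\<exists>(d::nat) (c::nat \<Rightarrow> 'a). 0 < d \<and> (\<forall>j\<in>{1..d}. c j \<in> I [^]\<^bsub>ideals_set D\<^esub> j) \<and>
      (x [^]\<^bsub>D\<^esub> d) \<oplus>\<^bsub>D\<^esub> (\<Oplus>\<^bsub>D\<^esub>j\<in>{1..d}. c j \<otimes>\<^bsub>D\<^esub> x [^]\<^bsub>D\<^esub> (d - j)) = \<zero>\<^bsub>D\<^esub>)"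

definition integral_closure :: "('a, 'b) ring_scheme \<Rightarrow> 'a set \<Rightarrow> 'a set" where
  "integral_closure D I = {x \<in> carrier D. integral_over D I x}"

definition integrally_closed :: "('a, 'b) ring_scheme \<Rightarrow> 'a set \<Rightarrow> bool" where
  "integrally_closed D I \<longleftrightarrow> integral_closure D I = I"

end

theory Submission
  imports Defs
begin

text \<open>
  Lift \<open>A\<close> to a matrix \<open>a\<close> over \<open>D\<close>, regard \<open>a\<close> as a weighted complete directed graph on
  \<open>{1..n}\<close>, and call the product of the weights along a closed walk the weight of the walk.
  In these terms \<open>A\<close> is principled iff, for every \<open>S\<close>, the non-identity terms in the Leibniz
  formula of the minor \<open>det a\<^sub>S\<close> add up to an element of \<open>I\<close> (lemma \<open>principled_Quot_iff\<close>).
  The theorem follows from the stronger fact that over an integrally closed ideal these terms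
  do not merely cancel modulo \<open>I\<close>: each simple cycle of length at least two has weight in \<open>I\<close>
  (lemma \<open>simple_cycle_in_ideal\<close>).

  This is proved by induction on the length \<open>k\<close> of the cycle. Let \<open>S\<close> be its vertex set. A
  non-identity permutation of \<open>S\<close> which is not a single \<open>k\<close>-cycle contains a shorter
  nontrivial cycle, so its term lies in \<open>I\<close> by induction. The remaining terms, those of the
  \<open>k\<close>-cycles on \<open>S\<close>, therefore have their sum in \<open>I\<close>. If \<open>x\<close> and \<open>y\<close> are the terms of two
  different \<open>k\<close>-cycles, then \<open>x y \<in> I\<^sup>2\<close>: the edges of both cycles together
  can be recombined into two closed walks without loops whose lengths are not divisible by \<open>k\<close>
  (lemma \<open>full_cycles_recombine\<close>), and such a walk on \<open>k\<close> vertices always contains a simple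
  cycle shorter than \<open>k\<close>. Multiplying the relation \<open>x + (\<Sum> of the other terms) \<in> I\<close> by \<open>x\<close>
  gives \<open>x\<^sup>2 + b x + q = 0\<close> with \<open>b \<in> I\<close> and \<open>q \<in> I\<^sup>2\<close>. So \<open>x\<close> is integral over \<open>I\<close>,
  and \<open>x \<in> I\<close>.

  Once all nontrivial simple cycles vanish modulo \<open>I\<close>, so does every closed walk that visits two
  different vertices. An entry of \<open>a\<^sup>m\<close> is a sum of weights of walks between its two indices.
  A non-identity permutation moves some \<open>u\<close> to \<open>p u \<noteq> u\<close> and returns to \<open>u\<close> later, so its term for
  \<open>a\<^sup>m\<close> is a combination of weights of closed walks through \<open>u\<close> and \<open>p u\<close> and lies in \<open>I\<close>
  (lemma \<open>off_diagonal_in_ideal\<close>). Hence \<open>A\<^sup>m\<close> is principled.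
\<close>

section \<open>Walks and their weights\<close>

primrec walk_weight ::
  "('a, 'b) monoid_scheme \<Rightarrow> ('v \<Rightarrow> 'v \<Rightarrow> 'a) \<Rightarrow> 'v \<Rightarrow> 'v list \<Rightarrow> 'a" where
  "walk_weight G w u [] = \<one>\<^bsub>G\<^esub>"
| "walk_weight G w u (v # vs) = w u v \<otimes>\<^bsub>G\<^esub> walk_weight G w v vs"

text \<open>
  A nonempty list \<open>vs\<close> stands for the closed walk that starts at \<open>last vs\<close> and then visits the
  entries of \<open>vs\<close> in order. Every vertex visit occurs exactly once in the list, so the
  walk is a simple cycle iff the list is distinct, and its number of edges is the length of the list.
\<close>

definition closed_weight ::
  "('a, 'b) monoid_scheme \<Rightarrow> ('v \<Rightarrow> 'v \<Rightarrow> 'a) \<Rightarrow> 'v list \<Rightarrow> 'a" where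
  "closed_weight G w vs = walk_weight G w (last vs) vs"

lemma (in monoid) walk_weight_closed:
  assumes "\<forall>u v. w u v \<in> carrier G"
  shows "walk_weight G w u vs \<in> carrier G"
  by (induction vs arbitrary: u) (auto simp: assms)

lemma (in monoid) walk_weight_append:
  assumes "\<forall>u v. w u v \<in> carrier G"
  shows "walk_weight G w u (xs @ ys)
    = walk_weight G w u xs \<otimes> walk_weight G w (last (u # xs)) ys"
  by (induction xs arbitrary: u) (auto simp: assms walk_weight_closed[OF assms] m_assoc)

text \<open>
  A closed walk that visits \<open>y\<close> twice is a closed walk at \<open>y\<close> inserted into another closed walk.
\<close>

lemma (in comm_monoid) closed_weight_split:
  assumes w: "\<forall>u v. w u v \<in> carrier G"
  shows "closed_weight G w (xs @ y # ys @ y # zs)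
    = closed_weight G w (ys @ [y]) \<otimes> closed_weight G w (xs @ y # zs)"
proof -
  let ?W = "walk_weight G w"
  let ?u = "last (y # zs)"
  have "closed_weight G w (xs @ y # ys @ y # zs) = ?W ?u ((xs @ [y]) @ (ys @ [y]) @ zs)"
    unfolding closed_weight_def by simp
  also have "\<dots> = ?W ?u (xs @ [y]) \<otimes> (?W y (ys @ [y]) \<otimes> ?W y zs)"
    unfolding walk_weight_append[OF w] by simp
  also have "\<dots> = ?W y (ys @ [y]) \<otimes> (?W ?u (xs @ [y]) \<otimes> ?W y zs)"
    by (simp add: walk_weight_closed[OF w] m_lcomm)
  also have "?W ?u (xs @ [y]) \<otimes> ?W y zs = ?W ?u ((xs @ [y]) @ zs)"
    unfolding walk_weight_append[OF w] by simp
  finally show ?thesis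
    unfolding closed_weight_def by simp
qed

text \<open>
  Cutting a closed walk repeatedly at repeated vertices decomposes it into simple cycles. To
  show that the weight is in \<open>I\<close>, it is enough to follow one piece through all the cuts down to a
  simple cycle. The property \<open>Q\<close> is what guarantees that the final cycle is one of those already
  known to be in \<open>I\<close>. The lemma is applied with two properties: the length is not
  divisible by \<open>k\<close> and there are no loops, or the walk visits two different vertices.
\<close>

lemma (in ideal) closed_weight_in_ideal:
  assumes "cring R"
    and w: "\<forall>u v. w u v \<in> carrier R"
    and split: "\<And>xs y ys zs. Q (xs @ y # ys @ y # zs) \<Longrightarrow> Q (ys @ [y]) \<or> Q (xs @ y # zs)"
    and simple: "\<And>vs. Q vs \<Longrightarrow> distinct vs \<Longrightarrow> set vs \<subseteq> V \<Longrightarrow> closed_weight R w vs \<in> I"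
    and "Q vs" and "set vs \<subseteq> V"
  shows "closed_weight R w vs \<in> I"
  using assms(5,6)
proof (induction "length vs" arbitrary: vs rule: less_induct)
  case less
  interpret cring R by fact
  show ?case
  proof (cases "distinct vs")
    case True
    with less.prems show ?thesis by (intro simple)
  next
    case False
    then obtain xs y ys zs where vs: "vs = xs @ y # ys @ y # zs"
      using not_distinct_decomp[of vs] by auto
    have cl: "closed_weight R w us \<in> carrier R" for us
      unfolding closed_weight_def by (rule walk_weight_closed[OF w])
    have "closed_weight R w (ys @ [y]) \<in> I \<or> closed_weight R w (xs @ y # zs) \<in> I"
      using less.prems split[of xs y ys zs] vs
      by (auto intro!: less.hyps simp del: append_Cons)
    then show ?thesis
      unfolding vs closed_weight_split[OF w] using cl I_l_closed I_r_closed by auto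
  qed
qed

section \<open>Orbits of permutations\<close>

text \<open>
  The walk starts at \<open>u\<close>, which is not listed. When \<open>l\<close> is a return time of \<open>u\<close>, the last entry
  is \<open>u\<close>, and the list represents a closed walk in the sense of \<open>closed_weight\<close>.
\<close>

definition orbit_walk :: "('v \<Rightarrow> 'v) \<Rightarrow> 'v \<Rightarrow> nat \<Rightarrow> 'v list" where
  "orbit_walk p u l = map (\<lambda>i. (p ^^ Suc i) u) [0..<l]"

lemma orbit_walk_0 [simp]: "orbit_walk p u 0 = []"
  by (simp add: orbit_walk_def)

lemma orbit_walk_Suc: "orbit_walk p u (Suc l) = orbit_walk p u l @ [(p ^^ Suc l) u]"
  by (simp add: orbit_walk_def)

lemma length_orbit_walk [simp]: "length (orbit_walk p u l) = l"
  by (simp add: orbit_walk_def)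

lemma last_orbit_walk: "last (u # orbit_walk p u l) = (p ^^ l) u"
  by (cases l) (simp_all add: orbit_walk_Suc)

lemma orbit_walk_add: "orbit_walk p u (s + t) = orbit_walk p u s @ orbit_walk p ((p ^^ s) u) t"
proof (induction t)
  case (Suc t)
  have "(p ^^ Suc (s + t)) u = (p ^^ Suc t) ((p ^^ s) u)"
    by (metis add.commute add_Suc_right funpow_add o_apply)
  then show ?case using Suc by (simp only: orbit_walk_Suc add_Suc_right append_assoc)
qed simp

lemma set_orbit_walk_subset:
  assumes "p permutes S" "u \<in> S"
  shows "set (orbit_walk p u l) \<subseteq> S"
  using permutes_in_image[OF permutes_funpow[OF assms(1)]] assms(2)
  by (auto simp: orbit_walk_def simp del: funpow.simps)

text \<open>
  This converts between the two descriptions of a cycle: the walk along an orbit of \<open>p\<close>, and the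
  part of the Leibniz term of \<open>p\<close> that belongs to the orbit.
\<close>

lemma (in comm_monoid) walk_weight_orbit_walk:
  assumes w: "\<forall>u v. w u v \<in> carrier G"
    and "inj_on (\<lambda>i. (p ^^ i) u) {..<l}"
  shows "walk_weight G w u (orbit_walk p u l) = (\<Otimes>v\<in>(\<lambda>i. (p ^^ i) u) ` {..<l}. w v (p v))"
  using assms(2)
proof (induction l)
  case (Suc l)
  let ?O = "\<lambda>l. (\<lambda>i. (p ^^ i) u) ` {..<l}"
  have inj: "inj_on (\<lambda>i. (p ^^ i) u) {..<l}"
    using Suc.prems by (rule inj_on_subset) auto
  have notin: "(p ^^ l) u \<notin> ?O l"
    using inj_onD[OF Suc.prems, of l] by fastforce
  have "walk_weight G w u (orbit_walk p u (Suc l))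
      = (\<Otimes>v\<in>?O l. w v (p v)) \<otimes> w ((p ^^ l) u) (p ((p ^^ l) u))"
    unfolding orbit_walk_Suc walk_weight_append[OF w] last_orbit_walk Suc.IH[OF inj]
    by (simp add: w)
  also have "\<dots> = (\<Otimes>v\<in>insert ((p ^^ l) u) (?O l). w v (p v))"
    using notin by (subst finprod_insert) (auto simp: w m_comm)
  also have "insert ((p ^^ l) u) (?O l) = ?O (Suc l)"
    by (auto simp: lessThan_Suc)
  finally show ?case .
qed simp

lemma inj_on_orbit:
  assumes "inj p" and "\<And>t. 0 < t \<Longrightarrow> t < l \<Longrightarrow> (p ^^ t) u \<noteq> u"
  shows "inj_on (\<lambda>i. (p ^^ i) u) {..<l}"
proof -
  have *: False if "i < j" "j < l" "(p ^^ i) u = (p ^^ j) u" for i j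
    using funpow_diff[OF assms(1), of i j u] assms(2)[of "j - i"] that by simp
  show ?thesis
    by (rule inj_onI) (metis * lessThan_iff linorder_neqE_nat)
qed

lemma orbit_return:
  assumes "p permutes S" and "finite S" and "u \<in> S"
  obtains l where "0 < l" "l \<le> card S" "(p ^^ l) u = u" "inj_on (\<lambda>i. (p ^^ i) u) {..<l}"
    "(\<lambda>i. (p ^^ i) u) ` {..<l} \<subseteq> S"
proof -
  let ?l = "least_power p u"
  have perm: "permutation p"
    using assms permutation_permutes by blast
  have "(p ^^ t) u \<noteq> u" if "0 < t" "t < ?l" for t
    using least_power_le[of t p u] that by auto
  then have inj: "inj_on (\<lambda>i. (p ^^ i) u) {..<?l}"
    using inj_on_orbit[OF permutes_inj[OF assms(1)]] by blast
  have sub: "(\<lambda>i. (p ^^ i) u) ` {..<?l} \<subseteq> S"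
    using permutes_in_image[OF permutes_funpow[OF assms(1)]] assms(3) by auto
  have "?l \<le> card S"
    using card_mono[OF assms(2) sub] card_image[OF inj] by simp
  with least_power_of_permutation[OF perm] inj sub show thesis
    by (intro that) auto
qed

lemma (in comm_monoid) permutation_term_factor:
  assumes w: "\<forall>u v. w u v \<in> carrier G"
    and S: "finite S" "T \<subseteq> S"
  shows "(\<Otimes>v\<in>S. w v (p v)) = (\<Otimes>v\<in>T. w v (p v)) \<otimes> (\<Otimes>v\<in>S - T. w v (p v))"
proof -
  have "S = T \<union> (S - T)" using S by auto
  then have "(\<Otimes>v\<in>S. w v (p v)) = (\<Otimes>v\<in>T \<union> (S - T). w v (p v))" by simp
  also have "\<dots> = (\<Otimes>v\<in>T. w v (p v)) \<otimes> (\<Otimes>v\<in>S - T. w v (p v))"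
    using S by (intro finprod_Un_disjoint) (auto simp: w intro: finite_subset)
  finally show ?thesis .
qed

text \<open>
  On a finite nonempty \<open>S\<close>, the condition on return times forces every orbit to be all of
  \<open>S\<close>, so that \<open>p\<close> is a single cycle through all points of \<open>S\<close>.
\<close>

definition full_cycle :: "'v set \<Rightarrow> ('v \<Rightarrow> 'v) \<Rightarrow> bool" where
  "full_cycle S p \<longleftrightarrow> p permutes S \<and> (\<forall>u\<in>S. \<forall>l. 0 < l \<and> l < card S \<longrightarrow> (p ^^ l) u \<noteq> u)"

lemma funpow_fixed: "p u = u \<Longrightarrow> (p ^^ i) u = u"
  by (induction i) auto

text \<open>
  A permutation can fail to be a full cycle because of a fixed point, whose orbit is useless
  here: its weight is a diagonal entry. In that case any orbit of a moved point
  misses the fixed point, so it is also shorter than \<open>card S\<close>.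
\<close>

lemma short_orbit:
  assumes p: "p permutes S" "p \<noteq> id" and S: "finite S" and "\<not> full_cycle S p"
  obtains u l where "u \<in> S" "p u \<noteq> u" "0 < l" "l < card S" "(p ^^ l) u = u"
    "inj_on (\<lambda>i. (p ^^ i) u) {..<l}" "(\<lambda>i. (p ^^ i) u) ` {..<l} \<subseteq> S"
proof -
  obtain u t where ut: "u \<in> S" "0 < t" "t < card S" "(p ^^ t) u = u"
    using assms unfolding full_cycle_def by blast
  obtain u' where u': "p u' \<noteq> u'" using p(2) by (auto simp: fun_eq_iff)
  then have "u' \<in> S" using p(1) by (meson permutes_not_in)
  define x where "x = (if p u = u then u' else u)"
  have x: "x \<in> S" "p x \<noteq> x"
    using ut u' \<open>u' \<in> S\<close> by (auto simp: x_def)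
  obtain l where l: "0 < l" "l \<le> card S" "(p ^^ l) x = x" "inj_on (\<lambda>i. (p ^^ i) x) {..<l}"
    "(\<lambda>i. (p ^^ i) x) ` {..<l} \<subseteq> S"
    using orbit_return[OF p(1) S x(1)] .
  have "l \<noteq> card S"
  proof
    assume eq: "l = card S"
    have "(\<lambda>i. (p ^^ i) x) ` {..<l} = S"
      using l(4,5) S eq by (intro card_subset_eq) (auto simp: card_image)
    then obtain i where i: "i < l" "(p ^^ i) x = u" using ut(1) by blast
    show False
    proof (cases "p u = u")
      case True
      have "(p ^^ l) x = (p ^^ (l - i)) ((p ^^ i) x)"
        using i(1) by (metis add.commute funpow_add less_imp_le_nat o_apply ordered_cancel_comm_monoid_diff_class.add_diff_inverse)
      then have "x = u" using l(3) i(2) funpow_fixed[of p u, OF True] by simp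
      with x True show False by simp
    next
      case False
      then have "x = u" by (simp add: x_def)
      then have "t = 0"
        using inj_onD[OF l(4), of t 0] ut eq l(1) by auto
      with ut show False by simp
    qed
  qed
  with l x that[of x l] show thesis by simp
qed

section \<open>Integral dependence of degree two\<close>

lemma (in ideal) ideals_set_pow:
  assumes "cring R"
  shows "I [^]\<^bsub>ideals_set R\<^esub> (1::nat) = I" and "I [^]\<^bsub>ideals_set R\<^esub> (2::nat) = ideal_prod R I I"
proof -
  interpret cring R by fact
  interpret S: semiring "ideals_set R" by (rule ideals_set_is_semiring)
  have I: "I \<in> carrier (ideals_set R)"
    using is_ideal by (simp add: ideals_set_def)
  show "I [^]\<^bsub>ideals_set R\<^esub> (1::nat) = I"
    using I by simp
  then show "I [^]\<^bsub>ideals_set R\<^esub> (2::nat) = ideal_prod R I I"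
    using I by (simp add: numeral_2_eq_2) (simp add: ideals_set_def)
qed

lemma (in ideal) quadratic_root_in_integrally_closed:
  assumes "cring R" and "integrally_closed R I"
    and x: "x \<in> carrier R" and b: "b \<in> I" and q: "q \<in> ideal_prod R I I"
    and eq: "x \<otimes> x \<oplus> (b \<otimes> x \<oplus> q) = \<zero>"
  shows "x \<in> I"
proof -
  interpret cring R by fact
  define c where "c = (\<lambda>j::nat. if j = 1 then b else q)"
  have bq: "b \<in> carrier R" "q \<in> carrier R"
    using b q ideal_prod_in_carrier[OF is_ideal is_ideal] Icarr by auto
  have set12: "{1..2::nat} = {1, 2}" by auto
  have "(\<Oplus>j\<in>{1..2}. c j \<otimes> x [^] (2 - j)) = b \<otimes> x \<oplus> q"
    unfolding set12 using x bq by (subst finsum_insert) (auto simp: c_def)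
  then have "x [^] (2::nat) \<oplus> (\<Oplus>j\<in>{1..2}. c j \<otimes> x [^] (2 - j)) = \<zero>"
    using eq x by (simp add: numeral_2_eq_2)
  moreover have "\<forall>j\<in>{1..2}. c j \<in> I [^]\<^bsub>ideals_set R\<^esub> j"
    using b q ideals_set_pow[OF \<open>cring R\<close>] unfolding set12 by (simp add: c_def)
  ultimately have "integral_over R I x"
    unfolding integral_over_def by (intro exI[of _ 2] exI[of _ c]) auto
  then show ?thesis
    using assms(2) x unfolding integrally_closed_def integral_closure_def by blast
qed

lemma (in ideal) finsum_in_ideal:
  assumes "\<And>i. i \<in> A \<Longrightarrow> f i \<in> I"
  shows "(\<Oplus>i\<in>A. f i) \<in> I"
  using assms
proof (induction A rule: infinite_finite_induct)
  case (insert i A)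
  then have "f \<in> A \<rightarrow> carrier R" "f i \<in> carrier R" using Icarr by auto
  with insert show ?case by simp
qed simp_all

text \<open>
  If all cross products \<open>y s \<cdot> y t\<close> are in \<open>I\<^sup>2\<close>, then multiplying the sum by \<open>y s\<close> turns it into a
  quadratic equation of integral dependence for \<open>y s\<close>. Summands that
  already lie in \<open>I\<close> are moved into the linear coefficient.
\<close>

lemma (in ideal) summand_in_integrally_closed:
  assumes "cring R" and "integrally_closed R I"
    and N: "finite N" "s \<in> N" and y: "\<And>t. t \<in> N \<Longrightarrow> y t \<in> carrier R"
    and sum: "(\<Oplus>t\<in>N. y t) \<in> I"
    and others: "\<And>t. t \<in> N \<Longrightarrow> t \<noteq> s \<Longrightarrow> y t \<in> I \<or> y s \<otimes> y t \<in> ideal_prod R I I"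
  shows "y s \<in> I"
proof -
  interpret cring R by fact
  interpret II: ideal "ideal_prod R I I" R
    by (rule ideal_prod_is_ideal[OF is_ideal is_ideal])
  define G where "G = {t \<in> N - {s}. y t \<in> I}"
  define F where "F = {t \<in> N - {s}. y t \<notin> I}"
  define f where "f = (\<Oplus>t\<in>F. y t)"
  define g where "g = (\<Oplus>t\<in>G. y t)"
  define S where "S = (\<Oplus>t\<in>N. y t)"
  have fin: "finite F" "finite G" using N by (auto simp: F_def G_def)
  have cl: "y \<in> F \<rightarrow> carrier R" "y \<in> G \<rightarrow> carrier R" "y s \<in> carrier R"
    using y N by (auto simp: F_def G_def)
  have g: "g \<in> I" unfolding g_def by (rule finsum_in_ideal) (simp add: G_def)
  have S: "S \<in> I" using sum by (simp add: S_def)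
  have carr: "f \<in> carrier R" "g \<in> carrier R" "S \<in> carrier R"
    using cl g S Icarr by (auto simp: f_def)
  have N_eq: "N = insert s (F \<union> G)" using N by (auto simp: F_def G_def)
  have eq: "S = y s \<oplus> (f \<oplus> g)"
    unfolding S_def N_eq f_def g_def
    using fin cl by (subst finsum_insert, auto simp: F_def G_def intro!: finsum_Un_disjoint)
  have "y s \<otimes> f \<in> ideal_prod R I I"
    unfolding f_def using cl fin others
    by (subst finsum_rdistr) (auto intro!: II.finsum_in_ideal simp: F_def)
  moreover have "g \<ominus> S \<in> I"
    using g S by (simp add: minus_eq)
  moreover have "y s \<otimes> y s \<oplus> ((g \<ominus> S) \<otimes> y s \<oplus> y s \<otimes> f) = \<zero>"
    unfolding eq using carr cl by algebra
  ultimately show ?thesis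
    using quadratic_root_in_integrally_closed[OF assms(1,2)] cl by blast
qed

section \<open>Cycles of a principled matrix\<close>

definition off_diagonal ::
  "('a, 'b) ring_scheme \<Rightarrow> ('v \<Rightarrow> 'v \<Rightarrow> 'a) \<Rightarrow> 'v set \<Rightarrow> 'a" where
  "off_diagonal R w S =
    (\<Oplus>\<^bsub>R\<^esub>p\<in>{p. p permutes S} - {id}. add_pow R (sign p) (\<Otimes>\<^bsub>R\<^esub>v\<in>S. w v (p v)))"

lemma distinct_adj_orbit_walk:
  assumes "\<And>i. p ((p ^^ i) u) \<noteq> (p ^^ i) u"
  shows "distinct_adj (u # orbit_walk p u l)"
proof (induction l)
  case (Suc l)
  have "last (u # orbit_walk p u l) \<noteq> (p ^^ Suc l) u"
    unfolding last_orbit_walk using assms[of l] by simp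
  then show ?case
    unfolding orbit_walk_Suc using Suc distinct_adj_append_iff[of "u # orbit_walk p u l"]
    by simp
qed simp

lemma full_cycle_orbit:
  assumes "full_cycle S p" "finite S" "u \<in> S"
  shows "(p ^^ card S) u = u" "inj_on (\<lambda>i. (p ^^ i) u) {..<card S}"
    "(\<lambda>i. (p ^^ i) u) ` {..<card S} = S"
proof -
  have p: "p permutes S" using assms by (simp add: full_cycle_def)
  obtain l where l: "0 < l" "l \<le> card S" "(p ^^ l) u = u" "inj_on (\<lambda>i. (p ^^ i) u) {..<l}"
    "(\<lambda>i. (p ^^ i) u) ` {..<l} \<subseteq> S"
    using orbit_return[OF p assms(2,3)] .
  moreover have eq: "l = card S"
    using l assms unfolding full_cycle_def by (meson le_neq_implies_less)
  ultimately show "(p ^^ card S) u = u" and inj: "inj_on (\<lambda>i. (p ^^ i) u) {..<card S}"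
    by simp_all
  show "(\<lambda>i. (p ^^ i) u) ` {..<card S} = S"
    using l(5) inj assms(2) unfolding eq by (intro card_subset_eq) (auto simp: card_image)
qed

lemma full_cycle_no_fixpoint:
  assumes "full_cycle S p" "u \<in> S" "2 \<le> card S"
  shows "p ((p ^^ i) u) \<noteq> (p ^^ i) u"
proof -
  have "(p ^^ i) u \<in> S"
    using assms permutes_in_image[OF permutes_funpow] by (metis full_cycle_def)
  then have "(p ^^ 1) ((p ^^ i) u) \<noteq> (p ^^ i) u"
    using assms(1,3) unfolding full_cycle_def by (metis Suc_1 Suc_le_lessD zero_less_one)
  then show ?thesis by simp
qed

text \<open>
  Among closed walks without loops on \<open>k\<close> vertices, those whose length is not a multiple of \<open>k\<close>
  are certain to contain a simple cycle shorter than \<open>k\<close>. The property survives cutting,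
  because the lengths of the two pieces add up to the length of the walk. The list \<open>last vs # vs\<close>
  contains all edges of the closed walk, including the one from its last entry back to the first.
\<close>

definition loopless_aperiodic :: "nat \<Rightarrow> 'v list \<Rightarrow> bool" where
  "loopless_aperiodic k vs \<longleftrightarrow> \<not> k dvd length vs \<and> distinct_adj (last vs # vs)"

lemma loopless_aperiodic_split:
  assumes "loopless_aperiodic k (xs @ y # ys @ y # zs)"
  shows "loopless_aperiodic k (ys @ [y]) \<or> loopless_aperiodic k (xs @ y # zs)"
proof -
  have adj: "distinct_adj (last (y # zs) # xs @ y # ys @ y # zs)"
    using assms by (simp add: loopless_aperiodic_def)
  have a: "distinct_adj ((last (y # zs) # xs) @ [y] @ ys @ [y] @ zs)" using adj by simp
  have "distinct_adj (y # ys @ [y])"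
    using a unfolding distinct_adj_append_iff by (auto simp: distinct_adj_append_iff distinct_adj_Cons hd_append split: if_splits)
  moreover have "distinct_adj ((last (y # zs) # xs) @ [y] @ zs)"
    using a unfolding distinct_adj_append_iff by (auto simp: distinct_adj_append_iff distinct_adj_Cons hd_append split: if_splits)
  moreover have "\<not> k dvd length (ys @ [y]) \<or> \<not> k dvd length (xs @ y # zs)"
  proof (rule ccontr)
    assume "\<not> ?thesis"
    then have "k dvd length (ys @ [y]) + length (xs @ y # zs)" by (intro dvd_add) auto
    with assms show False by (simp add: loopless_aperiodic_def ac_simps)
  qed
  ultimately show ?thesis
    by (auto simp: loopless_aperiodic_def)
qed

text \<open>
  Since \<open>p \<noteq> q\<close>, some edge from \<open>i\<close> to \<open>j = p i\<close> of \<open>p\<close> is not an edge of \<open>q\<close>. The \<open>q\<close>-path from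
  \<open>j\<close> to \<open>i\<close>, closed up by this edge, has some length \<open>t + 1\<close> with \<open>1 < t + 1 < k\<close>. All other edges
  form the \<open>q\<close>-path from \<open>i\<close> to \<open>j\<close> followed by the \<open>p\<close>-path from \<open>j\<close> to \<open>i\<close>, a closed walk of
  length \<open>2 k - (t + 1)\<close>. Neither length is divisible by \<open>k = card S\<close>.
\<close>

lemma (in cring) full_cycles_recombine:
  assumes w: "\<forall>u v. w u v \<in> carrier R"
    and S: "finite S" "2 \<le> card S"
    and p: "full_cycle S p" and q: "full_cycle S q" and "p \<noteq> q"
  obtains xs ys where "loopless_aperiodic (card S) xs" "set xs \<subseteq> S"
    "loopless_aperiodic (card S) ys" "set ys \<subseteq> S"
    "(\<Otimes>v\<in>S. w v (p v)) \<otimes> (\<Otimes>v\<in>S. w v (q v)) = closed_weight R w xs \<otimes> closed_weight R w ys"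
proof -
  let ?k = "card S" and ?W = "walk_weight R w"
  have perm: "p permutes S" "q permutes S"
    using p q by (auto simp: full_cycle_def)
  obtain i where i: "p i \<noteq> q i" using \<open>p \<noteq> q\<close> by (auto simp: fun_eq_iff)
  then have iS: "i \<in> S" using perm by (metis permutes_not_in)
  define j where "j = p i"
  have jS: "j \<in> S" unfolding j_def using permutes_in_image[OF perm(1)] iS by blast
  have ij: "j \<noteq> i"
    using full_cycle_no_fixpoint[OF p iS S(2), of 0] by (simp add: j_def)
  obtain t where t: "t < ?k" "(q ^^ t) j = i"
    using full_cycle_orbit(3)[OF q S(1) jS] iS by (metis (mono_tags, lifting) imageE lessThan_iff)
  have t0: "t \<noteq> 0" using t ij by (metis funpow_0)
  \<comment> \<open>A \<open>q\<close>-path from \<open>j\<close> to \<open>i\<close> of length \<open>k - 1\<close> would be continued by the edge from \<open>i\<close> to \<open>j\<close>.\<close>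
  have "Suc t \<noteq> ?k"
  proof
    assume "Suc t = ?k"
    then have "q i = j"
      using full_cycle_orbit(1)[OF q S(1) jS] t by (metis funpow.simps(2) o_apply)
    with i show False by (simp add: j_def)
  qed
  with t have tk: "Suc t < ?k" by simp
  have qback: "(q ^^ (?k - t)) i = j"
  proof -
    have "(q ^^ (?k - t)) ((q ^^ t) j) = (q ^^ ?k) j"
      using t(1) by (metis funpow_add le_add_diff_inverse2 less_imp_le_nat o_apply)
    then show ?thesis using t full_cycle_orbit(1)[OF q S(1) jS] by simp
  qed
  have pback: "(p ^^ (?k - 1)) j = i"
  proof -
    have "(p ^^ (?k - 1)) (p i) = (p ^^ Suc (?k - 1)) i" by (simp only: funpow_Suc_right o_apply)
    also have "Suc (?k - 1) = ?k" using S(2) by simp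
    finally show ?thesis using full_cycle_orbit(1)[OF p S(1) iS] by (simp add: j_def)
  qed
  define a where "a = orbit_walk q j t"
  define b where "b = orbit_walk q i (?k - t)"
  define c where "c = orbit_walk p j (?k - 1)"
  have last: "last (j # a) = i" "last (i # b) = j" "last (j # c) = i"
    unfolding a_def b_def c_def last_orbit_walk using t qback pback by auto
  have len: "length a = t" "length b = ?k - t" "length c = ?k - 1"
    by (simp_all add: a_def b_def c_def)
  have ne: "a \<noteq> []" "b \<noteq> []" "c \<noteq> []"
    unfolding length_greater_0_conv[symmetric] len using t t0 S(2) by auto
  have adj: "distinct_adj (j # a)" "distinct_adj (i # b)" "distinct_adj (j # c)"
    unfolding a_def b_def c_def
    using full_cycle_no_fixpoint[OF p _ S(2)] full_cycle_no_fixpoint[OF q _ S(2)] iS jS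
    by (auto intro!: distinct_adj_orbit_walk)
  have sub: "set a \<subseteq> S" "set b \<subseteq> S" "set c \<subseteq> S"
    unfolding a_def b_def c_def using set_orbit_walk_subset perm iS jS by metis+
  have prod: "(\<Otimes>v\<in>S. w v (r v)) = ?W j (orbit_walk r j ?k)" if "full_cycle S r" for r
    using walk_weight_orbit_walk[OF w full_cycle_orbit(2)[OF that S(1) jS]]
      full_cycle_orbit(3)[OF that S(1) jS] by simp
  have "orbit_walk q j ?k = a @ b"
    unfolding a_def b_def using orbit_walk_add[of q j t "?k - t"] t by simp
  then have wq: "(\<Otimes>v\<in>S. w v (q v)) = ?W j a \<otimes> ?W i b"
    using prod[OF q] walk_weight_append[OF w] last by simp
  have "orbit_walk p j ?k = c @ [j]"
  proof -
    have "orbit_walk p j (Suc (?k - 1)) = c @ [p ((p ^^ (?k - 1)) j)]"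
      unfolding c_def orbit_walk_Suc by simp
    then show ?thesis unfolding pback using S(2) by (simp add: j_def)
  qed
  then have wp: "(\<Otimes>v\<in>S. w v (p v)) = ?W j c \<otimes> ?W i [j]"
    using prod[OF p] walk_weight_append[OF w] last by simp
  have cl: "?W u vs \<in> carrier R" for u vs by (rule walk_weight_closed[OF w])
  show thesis
  proof (rule that[of "a @ [j]" "b @ c"])
    show "set (a @ [j]) \<subseteq> S" "set (b @ c) \<subseteq> S" using sub jS by auto
    have "distinct_adj (j # a @ [j])"
      using adj last ij distinct_adj_append_iff[of "j # a" "[j]"] by auto
    moreover have "\<not> ?k dvd Suc t" using tk by (meson Suc_neq_Zero dvd_imp_le not_less zero_less_Suc)
    ultimately show "loopless_aperiodic ?k (a @ [j])"
      using len by (simp add: loopless_aperiodic_def)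
    have "distinct_adj (i # b @ c)"
      using adj last ne distinct_adj_append_iff[of "i # b" c] by (auto simp: distinct_adj_Cons)
    moreover have "\<not> ?k dvd length (b @ c)"
    proof
      assume "?k dvd length (b @ c)"
      moreover have "length (b @ c) + Suc t = 2 * ?k" using len tk S(2) by simp
      ultimately have "?k dvd Suc t" by (metis dvd_add_right_iff dvd_triv_right)
      with \<open>\<not> ?k dvd Suc t\<close> show False ..
    qed
    ultimately show "loopless_aperiodic ?k (b @ c)"
      using last ne by (simp add: loopless_aperiodic_def)
    have "closed_weight R w (a @ [j]) = ?W j a \<otimes> ?W i [j]"
      using walk_weight_append[OF w, of j a "[j]"] last by (simp add: closed_weight_def)
    moreover have "closed_weight R w (b @ c) = ?W i b \<otimes> ?W j c"
      using walk_weight_append[OF w, of i b c] last ne by (simp add: closed_weight_def)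
    ultimately show "(\<Otimes>v\<in>S. w v (p v)) \<otimes> (\<Otimes>v\<in>S. w v (q v))
        = closed_weight R w (a @ [j]) \<otimes> closed_weight R w (b @ c)"
      unfolding wp wq using cl w by (simp add: m_ac)
  qed
qed

text \<open>
  Every simple cycle of length at least two is the orbit walk of a non-identity permutation of
  its vertex set, so its weight is one of the non-identity Leibniz terms.
\<close>

lemma closed_walk_permutation:
  assumes vs: "distinct vs" "2 \<le> length vs"
  obtains p where "p permutes set vs" "p \<noteq> id" "orbit_walk p (last vs) (length vs) = vs"
    "inj_on (\<lambda>i. (p ^^ i) (last vs)) {..<length vs}"
    "(\<lambda>i. (p ^^ i) (last vs)) ` {..<length vs} = set vs"
proof -
  let ?k = "length vs"
  define p where "p = cycle_of_list vs"
  have p: "p permutes set vs" unfolding p_def by (rule cycle_permutes)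
  have ne: "vs \<noteq> []" using vs by auto
  have walk: "(p ^^ Suc i) (last vs) = vs ! i" if "i < ?k" for i
  proof -
    have "(p ^^ Suc i) (vs ! (?k - 1)) = rotate (Suc i) vs ! (?k - 1)"
      using cyclic_rotation[OF vs(1), of "Suc i"] ne unfolding p_def[symmetric]
      by (metis diff_less length_greater_0_conv nth_map zero_less_one)
    also have "\<dots> = vs ! ((Suc i + (?k - 1)) mod ?k)"
      using ne by (intro nth_rotate) simp
    also have "(Suc i + (?k - 1)) mod ?k = i"
      proof -
      have "Suc i + (?k - 1) = i + ?k" using ne by (cases vs) simp_all
      then show ?thesis using that by simp
    qed
    finally show ?thesis using ne by (simp add: last_conv_nth)
  qed
  have orb: "orbit_walk p (last vs) ?k = vs"
    by (rule nth_equalityI) (simp_all add: orbit_walk_def walk del: funpow.simps)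
  have "p (last vs) \<noteq> last vs"
    using walk[of 0] vs ne by (auto simp: last_conv_nth nth_eq_iff_index_eq)
  then have nid: "p \<noteq> id" by auto
  have "(p ^^ t) (last vs) \<noteq> last vs" if "0 < t" "t < ?k" for t
    using walk[of "t - 1"] that vs ne by (auto simp: last_conv_nth nth_eq_iff_index_eq)
  then have inj: "inj_on (\<lambda>i. (p ^^ i) (last vs)) {..<?k}"
    using inj_on_orbit[OF permutes_inj[OF p]] by blast
  have "(\<lambda>i. (p ^^ i) (last vs)) ` {..<?k} \<subseteq> set vs"
    using permutes_in_image[OF permutes_funpow[OF p]] ne by auto
  then have "(\<lambda>i. (p ^^ i) (last vs)) ` {..<?k} = set vs"
    using inj vs(1) by (intro card_subset_eq) (auto simp: card_image distinct_card)
  with that p nid orb inj show thesis by blast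
qed

lemma (in cring) sign_multiple:
  assumes "x \<in> carrier R"
  shows "add_pow R (sign p) x = x \<or> add_pow R (sign p) x = \<ominus> x"
  using assms by (cases "evenperm p") (simp_all add: sign_def add.int_pow_neg)

lemma distinct_orbit_walk:
  assumes "inj p" "inj_on (\<lambda>i. (p ^^ i) u) {..<l}"
  shows "distinct (orbit_walk p u l)"
proof -
  have "inj_on (\<lambda>i. p ((p ^^ i) u)) {..<l}"
    using assms by (auto simp: inj_on_def)
  then show ?thesis by (simp add: orbit_walk_def distinct_map atLeast0LessThan)
qed

text \<open>
  The term of a permutation is a multiple of the weight of each of its orbits.
\<close>

lemma (in ideal) permutation_term_in_ideal:
  assumes "cring R" and w: "\<forall>u v. w u v \<in> carrier R"
    and p: "p permutes S" and S: "finite S" and u: "u \<in> S"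
    and l: "0 < l" "(p ^^ l) u = u" "inj_on (\<lambda>i. (p ^^ i) u) {..<l}"
      "(\<lambda>i. (p ^^ i) u) ` {..<l} \<subseteq> S"
    and cyc: "closed_weight R w (orbit_walk p u l) \<in> I"
  shows "(\<Otimes>v\<in>S. w v (p v)) \<in> I"
proof -
  interpret cring R by fact
  have "last (orbit_walk p u l) = u"
    using last_orbit_walk[of u p l] l by (cases "orbit_walk p u l") (auto dest: arg_cong[of _ _ length])
  then have "(\<Otimes>v\<in>(\<lambda>i. (p ^^ i) u) ` {..<l}. w v (p v)) \<in> I"
    using cyc walk_weight_orbit_walk[OF w l(3)] by (simp add: closed_weight_def)
  then show ?thesis
    using permutation_term_factor[OF w S l(4), of p] by (simp add: I_r_closed w)
qed

text \<open>
  The heart of the proof: the vanishing of the sums of non-identity terms modulo \<open>I\<close>, for all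
  vertex sets, already forces each single cycle into \<open>I\<close>. Integral closedness enters through
  the quadratic equation satisfied by the term of a full cycle.
\<close>

lemma (in ideal) simple_cycle_in_ideal:
  assumes "cring R" and "integrally_closed R I" and w: "\<forall>u v. w u v \<in> carrier R"
    and off: "\<And>S. S \<subseteq> V \<Longrightarrow> off_diagonal R w S \<in> I"
    and "distinct vs" "2 \<le> length vs" "set vs \<subseteq> V"
  shows "closed_weight R w vs \<in> I"
  using assms(5-7)
proof (induction "length vs" arbitrary: vs rule: less_induct)
  case less
  interpret cring R by fact
  define S where "S = set vs"
  have S: "finite S" "S \<subseteq> V" "card S = length vs" "2 \<le> card S"
    using less.prems by (auto simp: S_def distinct_card)
  \<comment> \<open>The terms \<open>y p\<close> with sign add up to an element of \<open>I\<close>; the cycle weights are the \<open>x p\<close>.\<close>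
  define x where "x = (\<lambda>p. \<Otimes>v\<in>S. w v (p v))"
  define y where "y = (\<lambda>p. add_pow R (sign p) (x p))"
  have xc: "x p \<in> carrier R" for p by (simp add: x_def w)
  have yx: "y p = x p \<or> y p = \<ominus> x p" for p
    unfolding y_def by (rule sign_multiple[OF xc])
  have yc: "y p \<in> carrier R" for p using yx[of p] xc[of p] by auto
  have walks: "closed_weight R w us \<in> I" if "loopless_aperiodic (card S) us" "set us \<subseteq> S" for us
  proof (rule closed_weight_in_ideal[of w "loopless_aperiodic (card S)" S])
    fix us assume us: "loopless_aperiodic (card S) us" "distinct us" "set us \<subseteq> S"
    have "length us \<le> card S"
      using us S card_mono[of S "set us"] by (simp add: distinct_card)
    moreover have "length us \<noteq> card S" "length us \<noteq> 0"
      using us by (auto simp: loopless_aperiodic_def)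
    moreover have "length us \<noteq> 1"
      using us by (auto simp: loopless_aperiodic_def length_Suc_conv)
    ultimately have "length us < length vs" "2 \<le> length us"
      using S(3) by linarith+
    then show "closed_weight R w us \<in> I"
      using us S by (intro less.hyps) auto
  qed (use that assms in \<open>auto dest!: loopless_aperiodic_split\<close>)
  have short: "y p \<in> I" if p: "p permutes S" "p \<noteq> id" "\<not> full_cycle S p" for p
  proof -
    obtain u l where u: "u \<in> S" "p u \<noteq> u" and l: "0 < l" "l < card S" "(p ^^ l) u = u"
      "inj_on (\<lambda>i. (p ^^ i) u) {..<l}" "(\<lambda>i. (p ^^ i) u) ` {..<l} \<subseteq> S"
      using short_orbit[OF p(1,2) S(1) p(3)] .
    have "l \<noteq> 1" using u l by auto
    then have "closed_weight R w (orbit_walk p u l) \<in> I"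
      using l u S distinct_orbit_walk[OF permutes_inj[OF p(1)] l(4)] set_orbit_walk_subset[OF p(1) u(1)]
      by (intro less.hyps) auto
    then have "x p \<in> I"
      unfolding x_def using permutation_term_in_ideal[OF \<open>cring R\<close> w p(1) S(1) u(1) l(1,3,4,5)] by simp
    then show ?thesis using yx[of p] by auto
  qed
  have full: "y p \<otimes> y q \<in> ideal_prod R I I"
    if pq: "full_cycle S p" "full_cycle S q" "p \<noteq> q" for p q
  proof -
    interpret II: ideal "ideal_prod R I I" R
      by (rule ideal_prod_is_ideal[OF is_ideal is_ideal])
    obtain as bs where ab: "loopless_aperiodic (card S) as" "set as \<subseteq> S"
      "loopless_aperiodic (card S) bs" "set bs \<subseteq> S"
      "x p \<otimes> x q = closed_weight R w as \<otimes> closed_weight R w bs"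
      unfolding x_def using full_cycles_recombine[OF w S(1,4) pq] .
    have "x p \<otimes> x q \<in> ideal_prod R I I"
      unfolding ab(5) using ab walks by (intro ideal_prod.prod) auto
    then show ?thesis
      using yx[of p] yx[of q] xc[of p] xc[of q] by (auto simp: l_minus r_minus)
  qed
  obtain p where p: "p permutes set vs" "p \<noteq> id" "orbit_walk p (last vs) (length vs) = vs"
    "inj_on (\<lambda>i. (p ^^ i) (last vs)) {..<length vs}"
    "(\<lambda>i. (p ^^ i) (last vs)) ` {..<length vs} = set vs"
    using closed_walk_permutation[OF less.prems(1,2)] .
  have "y p \<in> I"
  proof (cases "full_cycle S p")
    case True
    show ?thesis
    proof (rule summand_in_integrally_closed[OF assms(1,2), of "{p. p permutes S} - {id}" p y])
      show "(\<Oplus>p\<in>{p. p permutes S} - {id}. y p) \<in> I"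
        using off[OF S(2)] by (simp add: off_diagonal_def y_def x_def)
      show "finite ({p. p permutes S} - {id})" using finite_permutations[OF S(1)] by simp
      show "p \<in> {p. p permutes S} - {id}" using p by (simp add: S_def)
      show "y q \<in> I \<or> y p \<otimes> y q \<in> ideal_prod R I I"
        if "q \<in> {p. p permutes S} - {id}" "q \<noteq> p" for q
        using that short[of q] full[of p q] True by auto
    qed (rule yc)
  next
    case False
    with p short show ?thesis by (simp add: S_def)
  qed
  then have "\<ominus> y p \<in> I" by simp
  with \<open>y p \<in> I\<close> have "x p \<in> I"
    using yx[of p] xc[of p] by (metis minus_minus)
  then show ?case
    using walk_weight_orbit_walk[OF w p(4)] p(3,5) by (simp add: closed_weight_def x_def S_def)
qed

section \<open>Powers of a matrix without cycles\<close>

lemma (in ideal) nonconstant_closed_walk_in_ideal: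
  assumes "cring R" and w: "\<forall>u v. w u v \<in> carrier R"
    and cycle: "\<And>vs. distinct vs \<Longrightarrow> 2 \<le> length vs \<Longrightarrow> set vs \<subseteq> V \<Longrightarrow> closed_weight R w vs \<in> I"
    and uv: "u \<in> set vs" "v \<in> set vs" "u \<noteq> v" and V: "set vs \<subseteq> V"
  shows "closed_weight R w vs \<in> I"
proof -
  define Q where "Q = (\<lambda>vs :: 'c list. \<exists>u\<in>set vs. \<exists>v\<in>set vs. u \<noteq> v)"
  show ?thesis
  proof (rule closed_weight_in_ideal[OF assms(1) w, where Q = Q and V = V])
    fix vs :: "'c list" assume vs: "Q vs" "distinct vs" "set vs \<subseteq> V"
    then have "2 \<le> length vs"
      by (cases vs; cases "tl vs") (auto simp: Q_def)
    with vs show "closed_weight R w vs \<in> I" by (intro cycle)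
  next
    fix xs :: "'c list" and y ys zs
    assume "Q (xs @ y # ys @ y # zs)"
    then obtain u where "u \<in> set (xs @ y # ys @ y # zs)" "u \<noteq> y"
      unfolding Q_def by metis
    then show "Q (ys @ [y]) \<or> Q (xs @ y # zs)"
      by (auto simp: Q_def)
  qed (use uv V in \<open>auto simp: Q_def\<close>)
qed

text \<open>
  The additive span of the weights of the walks inside \<open>V\<close> from \<open>u\<close> to \<open>v\<close>. For \<open>V = {1..n}\<close>
  it contains the entry \<open>(u, v)\<close> of every power of \<open>w\<close>, and membership is stable under concatenation;
  this replaces the explicit expansion of a product of powers into a sum over walks.
\<close>

inductive_set walk_span ::
  "('a, 'b) ring_scheme \<Rightarrow> ('v \<Rightarrow> 'v \<Rightarrow> 'a) \<Rightarrow> 'v set \<Rightarrow> 'v \<Rightarrow> 'v \<Rightarrow> 'a set"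
  for R (structure) and w V u v where
  walk: "set vs \<subseteq> V \<Longrightarrow> last (u # vs) = v \<Longrightarrow> walk_weight R w u vs \<in> walk_span R w V u v"
| zero: "\<zero> \<in> walk_span R w V u v"
| add: "x \<in> walk_span R w V u v \<Longrightarrow> y \<in> walk_span R w V u v \<Longrightarrow> x \<oplus> y \<in> walk_span R w V u v"

context cring
begin

lemma walk_span_closed:
  assumes w: "\<forall>u v. w u v \<in> carrier R" and "x \<in> walk_span R w V u v"
  shows "x \<in> carrier R"
  using assms(2) by induction (auto intro: walk_weight_closed[OF w])

lemma walk_span_mult:
  assumes w: "\<forall>u v. w u v \<in> carrier R"
    and x: "x \<in> walk_span R w V u v" and y: "y \<in> walk_span R w V v z"
  shows "x \<otimes> y \<in> walk_span R w V u z"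
proof -
  note cl = walk_span_closed[OF w]
  have walk: "walk_weight R w u vs \<otimes> y \<in> walk_span R w V u z"
    if vs: "set vs \<subseteq> V" "last (u # vs) = v" for vs
    using y
  proof induction
    case (walk us)
    then show ?case
      using walk_weight_append[OF w, of u vs us] vs walk_span.walk[of "vs @ us" V u z R w]
      by (cases us) auto
  next
    case zero
    then show ?case using walk_weight_closed[OF w] by (simp add: walk_span.zero)
  next
    case (add a b)
    then show ?case
      using walk_weight_closed[OF w] cl by (simp add: r_distr walk_span.add)
  qed
  show ?thesis using x
  proof induction
    case (add a b)
    then show ?case using cl y by (simp add: l_distr walk_span.add)
  qed (use walk cl y in \<open>auto intro: walk_span.zero\<close>)
qed

lemma walk_span_finsum:
  assumes w: "\<forall>u v. w u v \<in> carrier R"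
    and "\<And>i. i \<in> A \<Longrightarrow> f i \<in> walk_span R w V u v"
  shows "(\<Oplus>i\<in>A. f i) \<in> walk_span R w V u v"
  using assms(2)
proof (induction A rule: infinite_finite_induct)
  case (insert i A)
  have "f k \<in> carrier R" if "k \<in> insert i A" for k
    using insert.prems[OF that] by (rule walk_span_closed[OF w])
  with insert show ?case by (simp add: walk_span.add)
qed (auto intro: walk_span.zero)

lemma mat_power_closed:
  assumes "\<forall>i j. a i j \<in> carrier R"
  shows "mat_power R n a m i j \<in> carrier R"
  by (induction m arbitrary: j) (auto simp: mat_one_def mat_mult_def assms)

lemma mat_power_in_walk_span:
  assumes w: "\<forall>i j. a i j \<in> carrier R" and "j \<in> {1..n}"
  shows "mat_power R n a m i j \<in> walk_span R a {1..n} i j"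
  using assms(2)
proof (induction m arbitrary: j)
  case 0
  show ?case
    using walk_span.walk[of "[]" "{1..n}" i i R a] by (auto simp: mat_one_def walk_span.zero simp del: One_nat_def)
next
  case (Suc m)
  have "a k j \<in> walk_span R a {1..n} k j" for k
    using walk_span.walk[of "[j]" "{1..n}" k j R a] Suc.prems by (simp add: w)
  then show ?case
    by (auto simp: mat_mult_def simp del: One_nat_def intro!: walk_span_finsum[OF w] walk_span_mult[OF w] Suc.IH)
qed

lemma walk_weight_in_walk_span:
  assumes w: "\<forall>u v. w u v \<in> carrier R"
    and b: "\<And>u v. v \<in> V \<Longrightarrow> b u v \<in> walk_span R w V u v" and "set vs \<subseteq> V"
  shows "walk_weight R b u vs \<in> walk_span R w V u (last (u # vs))"
  using assms(3)
proof (induction vs arbitrary: u)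
  case Nil
  show ?case using walk_span.walk[of "[]" V u u R w] by simp
next
  case (Cons v vs)
  then have "walk_weight R b v vs \<in> walk_span R w V v (last (v # vs))" by simp
  with Cons.prems show ?case
    by (auto intro!: walk_span_mult[OF w] b simp del: last.simps) (simp add: b walk_span_mult[OF w])
qed

end

text \<open>
  Going from \<open>u\<close> to \<open>v \<noteq> u\<close> and back gives a closed walk that visits two different vertices.
\<close>

lemma (in ideal) walk_span_return_in_ideal:
  assumes "cring R" and w: "\<forall>u v. w u v \<in> carrier R"
    and cycle: "\<And>vs. distinct vs \<Longrightarrow> 2 \<le> length vs \<Longrightarrow> set vs \<subseteq> V \<Longrightarrow> closed_weight R w vs \<in> I"
    and x: "x \<in> walk_span R w V u v" and y: "y \<in> walk_span R w V v u" and "u \<noteq> v"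
  shows "x \<otimes> y \<in> I"
proof -
  interpret cring R by fact
  note cl = walk_span_closed[OF w]
  have walk: "walk_weight R w u vs \<otimes> y \<in> I" if vs: "set vs \<subseteq> V" "last (u # vs) = v" for vs
    using y
  proof induction
    case (walk us)
    have ne: "us \<noteq> []" "vs \<noteq> []" using walk vs \<open>u \<noteq> v\<close> by auto
    then have "last us = u" "last vs = v" using walk vs by auto
    then have "closed_weight R w (vs @ us) \<in> I"
      using ne walk vs \<open>u \<noteq> v\<close>
      by (intro nonconstant_closed_walk_in_ideal[OF \<open>cring R\<close> w cycle, of V u _ v])
        (auto dest: last_in_set)
    then show ?case
      using ne vs \<open>last us = u\<close> by (simp add: closed_weight_def walk_weight_append[OF w])
  next
    case (add a b)
    then show ?case using walk_weight_closed[OF w] cl by (simp add: r_distr)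
  qed (simp add: walk_weight_closed[OF w])
  show ?thesis using x
  proof induction
    case (add a b)
    then show ?case using cl y by (simp add: l_distr)
  qed (use walk cl y in auto)
qed

text \<open>
  A non-identity permutation moves some \<open>u\<close>. Its orbit goes from \<open>u\<close> to \<open>p u\<close> and from there
  back to \<open>u\<close>, and replacing each step by an element of the span of walks leaves a combination of
  weights of nonconstant closed walks.
\<close>

lemma (in ideal) off_diagonal_in_ideal:
  assumes "cring R" and w: "\<forall>u v. w u v \<in> carrier R" and b: "\<forall>u v. b u v \<in> carrier R"
    and cycle: "\<And>vs. distinct vs \<Longrightarrow> 2 \<le> length vs \<Longrightarrow> set vs \<subseteq> V \<Longrightarrow> closed_weight R w vs \<in> I"
    and span: "\<And>u v. v \<in> V \<Longrightarrow> b u v \<in> walk_span R w V u v"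
    and S: "S \<subseteq> V" "finite S"
  shows "off_diagonal R b S \<in> I"
proof -
  interpret cring R by fact
  have "add_pow R (sign p) (\<Otimes>v\<in>S. b v (p v)) \<in> I" if p: "p permutes S" "p \<noteq> id" for p
  proof -
    obtain u where u: "p u \<noteq> u" using p(2) by (auto simp: fun_eq_iff)
    then have uS: "u \<in> S" using p(1) by (meson permutes_not_in)
    obtain l where l: "0 < l" "l \<le> card S" "(p ^^ l) u = u" "inj_on (\<lambda>i. (p ^^ i) u) {..<l}"
      "(\<lambda>i. (p ^^ i) u) ` {..<l} \<subseteq> S"
      using orbit_return[OF p(1) S(2) uS] .
    define vs where "vs = orbit_walk p (p u) (l - 1)"
    have pu: "p u \<in> S" using permutes_in_image[OF p(1)] uS by simp
    have vs: "orbit_walk p u l = p u # vs"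
      using orbit_walk_add[of p u 1 "l - 1"] l(1) by (simp add: vs_def orbit_walk_def)
    have last: "last (p u # vs) = u"
      using last_orbit_walk[of u p l] l(3) unfolding vs by simp
    have "set vs \<subseteq> V"
      using set_orbit_walk_subset[OF p(1) pu] S(1) unfolding vs_def by blast
    then have "walk_weight R b (p u) vs \<in> walk_span R w V (p u) (last (p u # vs))"
      by (intro walk_weight_in_walk_span[OF w] span)
    then have return: "walk_weight R b (p u) vs \<in> walk_span R w V (p u) u"
      unfolding last .
    have step: "b u (p u) \<in> walk_span R w V u (p u)"
      using span pu S(1) by blast
    have "b u (p u) \<otimes> walk_weight R b (p u) vs \<in> I"
      by (rule walk_span_return_in_ideal[OF \<open>cring R\<close> w _ step return]) (use cycle u in auto)
    then have "closed_weight R b (orbit_walk p u l) \<in> I"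
      unfolding closed_weight_def vs last by simp
    then have "(\<Otimes>v\<in>S. b v (p v)) \<in> I"
      by (rule permutation_term_in_ideal[OF \<open>cring R\<close> b p(1) S(2) uS l(1,3,4,5)])
    then show ?thesis
      using sign_multiple[of "\<Otimes>v\<in>S. b v (p v)" p] b by auto
  qed
  then show ?thesis
    unfolding off_diagonal_def by (intro finsum_in_ideal) auto
qed

section \<open>Principled matrices over a quotient ring\<close>

lemma (in cring) principal_det_eq_off_diagonal:
  assumes w: "\<forall>i j. a i j \<in> carrier R" and S: "finite S"
  shows "principal_det R a S = (\<Otimes>i\<in>S. a i i) \<oplus> off_diagonal R a S"
proof -
  let ?y = "\<lambda>p. add_pow R (sign p) (\<Otimes>i\<in>S. a i (p i))"
  have P: "{p. p permutes S} = insert id ({p. p permutes S} - {id})"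
    using permutes_id by auto
  have "principal_det R a S = (\<Oplus>p\<in>insert id ({p. p permutes S} - {id}). ?y p)"
    unfolding principal_det_def using P by simp
  also have "\<dots> = ?y id \<oplus> off_diagonal R a S"
    unfolding off_diagonal_def using finite_permutations[OF S]
    by (intro finsum_insert) (auto simp: w)
  finally show ?thesis by (simp add: w)
qed

lemma (in ring_hom_cring) hom_principal_det:
  assumes a: "\<forall>i j. a i j \<in> carrier R"
    and A: "\<And>i j. i \<in> T \<Longrightarrow> j \<in> T \<Longrightarrow> A i j = h (a i j)"
  shows "principal_det S A T = h (principal_det R a T)"
proof -
  have sgn: "h (add_pow R (sign p) x) = add_pow S (sign p) (h x)" if "x \<in> carrier R" for p :: "nat \<Rightarrow> nat" and x
    using that by (cases "evenperm p") (simp_all add: sign_def R.add.int_pow_neg S.add.int_pow_neg)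
  have hdet: "h (principal_det R a T)
      = (\<Oplus>\<^bsub>S\<^esub>p\<in>{p. p permutes T}. add_pow S (sign p) (\<Otimes>\<^bsub>S\<^esub>i\<in>T. h (a i (p i))))"
    unfolding principal_det_def using a by (simp add: sgn comp_def hom_finprod)
  have "principal_det S A T
      = (\<Oplus>\<^bsub>S\<^esub>p\<in>{p. p permutes T}. add_pow S (sign p) (\<Otimes>\<^bsub>S\<^esub>i\<in>T. h (a i (p i))))"
    unfolding principal_det_def
  proof (intro S.finsum_cong')
    fix p assume "p \<in> {p. p permutes T}"
    then have "A i (p i) = h (a i (p i))" if "i \<in> T" for i
      using that A permutes_in_image[of p T] by auto
    then have "(\<Otimes>\<^bsub>S\<^esub>i\<in>T. A i (p i)) = (\<Otimes>\<^bsub>S\<^esub>i\<in>T. h (a i (p i)))"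
      using a by (intro S.finprod_cong') auto
    then show "add_pow S (sign p) (\<Otimes>\<^bsub>S\<^esub>i\<in>T. A i (p i)) = add_pow S (sign p) (\<Otimes>\<^bsub>S\<^esub>i\<in>T. h (a i (p i)))"
      by simp
  qed (use a in auto)
  with hdet show ?thesis by simp
qed

lemma (in ring_hom_cring) hom_mat_power:
  assumes a: "\<forall>i j. a i j \<in> carrier R"
    and A: "\<And>i j. i \<in> {1..n} \<Longrightarrow> j \<in> {1..n} \<Longrightarrow> A i j = h (a i j)"
    and ij: "i \<in> {1..n}" "j \<in> {1..n}"
  shows "mat_power S n A m i j = h (mat_power R n a m i j)"
  using ij
proof (induction m arbitrary: j)
  case 0
  show ?case by (simp add: mat_one_def)
next
  case (Suc m)
  have cl: "mat_power R n a m i k \<in> carrier R" for k by (rule R.mat_power_closed[OF a])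
  have "mat_power S n A (Suc m) i j
      = (\<Oplus>\<^bsub>S\<^esub>k\<in>{1..n}. h (mat_power R n a m i k \<otimes> a k j))"
    using Suc cl a A by (auto simp: mat_mult_def intro!: S.finsum_cong')
  also have "\<dots> = h (mat_power R n a (Suc m) i j)"
    using cl a by (simp add: mat_mult_def comp_def)
  finally show ?case .
qed

lemma (in ideal) a_coset_eq_zero_iff:
  assumes "x \<in> carrier R"
  shows "I +> x = \<zero>\<^bsub>R Quot I\<^esub> \<longleftrightarrow> x \<in> I"
  using assms a_rcos_const a_rcos_self[OF assms] by (auto simp: FactRing_def)

text \<open>
  The identity permutation contributes the product of the diagonal, so the defining equation of
  a principled matrix says exactly that the remaining terms vanish in the quotient.
\<close>

lemma (in ideal) principled_Quot_iff:
  assumes "cring R" and a: "\<forall>i j. a i j \<in> carrier R"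
    and A: "\<And>i j. i \<in> {1..n} \<Longrightarrow> j \<in> {1..n} \<Longrightarrow> A i j = I +> a i j"
  shows "principled (R Quot I) n A \<longleftrightarrow> (\<forall>S\<subseteq>{1..n}. off_diagonal R a S \<in> I)"
proof -
  interpret h: ring_hom_cring R "R Quot I" "(+>) I"
    by (rule rcos_ring_hom_cring[OF assms(1)])
  have "principal_det (R Quot I) A S = (\<Otimes>\<^bsub>R Quot I\<^esub>i\<in>S. A i i) \<longleftrightarrow> off_diagonal R a S \<in> I"
    if S: "S \<subseteq> {1..n}" for S
  proof -
    have fin: "finite S" using S finite_subset by blast
    have off: "off_diagonal R a S \<in> carrier R"
      unfolding off_diagonal_def using a by auto
    let ?d = "\<Otimes>i\<in>S. a i i"
    have d: "?d \<in> carrier R" using a by simp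
    have "(\<Otimes>\<^bsub>R Quot I\<^esub>i\<in>S. A i i) = (\<Otimes>\<^bsub>R Quot I\<^esub>i\<in>S. I +> a i i)"
      using A S a by (intro h.S.finprod_cong') auto
    then have diag: "(\<Otimes>\<^bsub>R Quot I\<^esub>i\<in>S. A i i) = I +> ?d"
      using a by (simp add: comp_def h.hom_finprod)
    have "principal_det (R Quot I) A S = I +> principal_det R a S"
      using S A by (intro h.hom_principal_det a) blast
    also have "\<dots> = (I +> ?d) \<oplus>\<^bsub>R Quot I\<^esub> (I +> off_diagonal R a S)"
      unfolding h.R.principal_det_eq_off_diagonal[OF a fin] using d off by simp
    finally have "principal_det (R Quot I) A S = (\<Otimes>\<^bsub>R Quot I\<^esub>i\<in>S. A i i)
        \<longleftrightarrow> I +> off_diagonal R a S = \<zero>\<^bsub>R Quot I\<^esub>"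
      unfolding diag using d off by (simp add: h.S.add.l_cancel_one[simplified])
    then show ?thesis using a_coset_eq_zero_iff[OF off] by simp
  qed
  then show ?thesis unfolding principled_def by blast
qed

theorem theorem1p9:
  fixes D :: "('a, 'b) ring_scheme"
    and I :: "'a set"
    and n m :: nat
    and A :: "nat \<Rightarrow> nat \<Rightarrow> 'a set"
  assumes "cring D"
    and "ideal I D"
    and "integrally_closed D I"
    and "A \<in> matrices (D Quot I) n"
    and "principled (D Quot I) n A"
  shows "principled (D Quot I) n (mat_power (D Quot I) n A m)"
proof -
  interpret D: cring D by fact
  interpret ideal I D by fact
  interpret h: ring_hom_cring D "D Quot I" "(+>\<^bsub>D\<^esub>) I"
    by (rule rcos_ring_hom_cring[OF assms(1)])
  have "\<exists>x. x \<in> carrier D \<and> (i \<in> {1..n} \<and> j \<in> {1..n} \<longrightarrow> A i j = I +>\<^bsub>D\<^esub> x)" for i j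
  proof (cases "i \<in> {1..n} \<and> j \<in> {1..n}")
    case True
    then have "A i j \<in> carrier (D Quot I)"
      using assms(4) unfolding matrices_def Pi_iff by blast
    then show ?thesis
      unfolding FactRing_def A_RCOSETS_def' by auto
  qed (use D.zero_closed in blast)
  then obtain a where "\<forall>i j. a i j \<in> carrier D \<and>
      (i \<in> {1..n} \<and> j \<in> {1..n} \<longrightarrow> A i j = I +>\<^bsub>D\<^esub> a i j)"
    by metis
  then have a: "\<forall>i j. a i j \<in> carrier D"
    and A: "\<And>i j. i \<in> {1..n} \<Longrightarrow> j \<in> {1..n} \<Longrightarrow> A i j = I +>\<^bsub>D\<^esub> a i j"
    by blast+
  have off: "off_diagonal D a S \<in> I" if "S \<subseteq> {1..n}" for S
    using assms(5) that principled_Quot_iff[OF assms(1) a A] by blast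
  have cycle: "closed_weight D a vs \<in> I"
    if "distinct vs" "2 \<le> length vs" "set vs \<subseteq> {1..n}" for vs
    by (rule simple_cycle_in_ideal[OF assms(1,3) a off that])
  have power: "\<forall>i j. mat_power D n a m i j \<in> carrier D"
    using D.mat_power_closed[OF a] by blast
  have "off_diagonal D (mat_power D n a m) S \<in> I" if S: "S \<subseteq> {1..n}" for S
    by (rule off_diagonal_in_ideal[OF assms(1) a power cycle D.mat_power_in_walk_span[OF a] S])
      (use S finite_subset in auto)
  then show ?thesis
    using principled_Quot_iff[OF assms(1) power h.hom_mat_power[OF a A]] by blast
qed

end
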